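(* Let $n$ be a positive integer with $l=n-1$ squarefree and $l\equiv7\pmod 8$, and let $W$ be a real $n\times n$ skew-symmetric matrix with zero diagonal, off-diagonal entries in $\{-1,1\}$ and $WW^\top=(n-1)I$. Let $\mathcal{O}=\mathbf{Z}[\frac{1+\sqrt{-l}}{2}]$ act on $\mathbf{R}^n$ via $(r+s\sqrt{-l})\mathbf{v}=\mathbf{v}(rI+sW)$. Let $L_0=\{(a_1,\ldots,a_n)\in\mathbf{Z}^n:\sum a_j\equiv0\pmod2\}$, $L_+=L_0\cup(\tfrac12\mathbf{e}_1(I+W)+L_0)$, $L_-=L_0\cup(\tfrac12\mathbf{e}_1(-I+W)+L_0)$, and let $L$ be $L_+$ or $L_-$. Let $\mathcal{I}$ be a nonzero ideal of $\mathcal{O}$ with norm $N=N(\mathcal{I})=|\mathcal{O}/\mathcal{I}|$, and set $L[\mathcal{I}]=\frac{1}{\sqrt N}\,\mathcal{I}L$. Then $L[\mathcal{I}]$ is an even unimodular lattice. Moreover, if $\mathcal{I}$ and $\mathcal{J}$ are nonzero ideals in the same ideal class of $\mathcal{O}$, then $L[\mathcal{I}]$ and $L[\mathcal{J}]$ are isometric.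
   Context: $\mathcal{I}L$ denotes the additive subgroup of $L$ generated by all $\alpha\mathbf{v}$ with $\alpha\in\mathcal{I}$, $\mathbf{v}\in L$. A lattice is even if all norms $\mathbf{u}\cdot\mathbf{u}$ are even integers, and unimodular if it is integral with covolume $1$. $\mathbf{e}_1$ is the first standard unit vector; vectors are row vectors. *)

theory Defs
  imports
    "HOL-Analysis.Analysis"
    "HOL-Algebra.Algebra"
    "HOL-Algebra.Algebraic_Closure_Type"
    "HOL-Computational_Algebra.Group_Closure"
    "HOL-Computational_Algebra.Squarefree"
    "HOL-Number_Theory.Cong"
begin

unbundle no fps_syntax

section \<open>Lattices in Euclidean space\<close>

definition lattice_basis :: "real^'n^'n \<Rightarrow> (real^'n) set \<Rightarrow> bool" where
  "lattice_basis B L \<longleftrightarrow>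
     det B \<noteq> 0 \<and> L = {\<Sum>i\<in>UNIV. of_int (c i) *\<^sub>R row i B | c :: 'n \<Rightarrow> int. True}"

definition is_lattice :: "(real^'n) set \<Rightarrow> bool" where
  "is_lattice L \<longleftrightarrow> (\<exists>B. lattice_basis B L)"

text \<open>The choice of basis is immaterial: see \<open>covolume_eq\<close> below.\<close>

definition covolume :: "(real^'n) set \<Rightarrow> real" where
  "covolume L = \<bar>det (SOME B. lattice_basis B L)\<bar>"

definition integral_lattice :: "(real^'n) set \<Rightarrow> bool" where
  "integral_lattice L \<longleftrightarrow> is_lattice L \<and> (\<forall>u\<in>L. \<forall>v\<in>L. u \<bullet> v \<in> \<int>)"

definition even_lattice :: "(real^'n) set \<Rightarrow> bool" where
  "even_lattice L \<longleftrightarrow> is_lattice L \<and> (\<forall>u\<in>L. \<exists>k::int. even k \<and> u \<bullet> u = of_int k)"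

definition unimodular_lattice :: "(real^'n) set \<Rightarrow> bool" where
  "unimodular_lattice L \<longleftrightarrow> integral_lattice L \<and> covolume L = 1"

definition isometric_lattices :: "(real^'n) set \<Rightarrow> (real^'n) set \<Rightarrow> bool" where
  "isometric_lattices L M \<longleftrightarrow> (\<exists>f. orthogonal_transformation f \<and> f ` L = M)"

lemma lattice_basis_row_mem:
  assumes "lattice_basis B L"
  shows "row i B \<in> L"
proof -
  have "row i B = (\<Sum>j\<in>UNIV. of_int (if j = i then 1 else 0) *\<^sub>R row j B)"
    by (simp add: if_distrib[of of_int] if_distrib[of "\<lambda>x. x *\<^sub>R _"] cong: if_cong)
  then show ?thesis
    using assms unfolding lattice_basis_def mem_Collect_eq
    by (intro ssubst[of L _ "\<lambda>S. row i B \<in> S"] CollectI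
        exI[of _ "\<lambda>j. if j = i then 1 else 0"]) auto
qed

lemma lattice_basis_change:
  fixes B C :: "real^'n^'n"
  assumes B: "lattice_basis B L" and C: "lattice_basis C L"
  obtains k :: int where "det C = of_int k * det B"
proof -
  have "\<exists>c :: 'n \<Rightarrow> int. row i C = (\<Sum>j\<in>UNIV. of_int (c j) *\<^sub>R row j B)" for i
    using lattice_basis_row_mem[OF C, of i] B unfolding lattice_basis_def by auto
  then obtain U :: "'n \<Rightarrow> 'n \<Rightarrow> int"
    where U: "\<And>i. row i C = (\<Sum>j\<in>UNIV. of_int (U i j) *\<^sub>R row j B)" by metis
  have "C = (\<chi> i j. of_int (U i j)) ** B"
  proof -
    have "C $ i $ k = (\<Sum>j\<in>UNIV. of_int (U i j) * B $ j $ k)" for i k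
    proof -
      have "C $ i $ k = row i C $ k" by (simp add: row_def)
      then show ?thesis unfolding U by (simp add: row_def sum_component)
    qed
    then show ?thesis by (simp add: vec_eq_iff matrix_matrix_mult_def)
  qed
  then have "det C = det (\<chi> i j. real_of_int (U i j) :: real^'n^'n) * det B"
    by (metis det_mul)
  moreover have "det (\<chi> i j. real_of_int (U i j) :: real^'n^'n)
      = of_int (\<Sum>p\<in>{p. p permutes UNIV}. sign p * (\<Prod>i\<in>UNIV. U i (p i)))"
    unfolding det_def by simp
  ultimately show ?thesis by (intro that) (simp only:)
qed

lemma covolume_eq:
  fixes B :: "real^'n^'n"
  assumes B: "lattice_basis B L"
  shows "covolume L = \<bar>det B\<bar>"
proof -
  define C where "C = (SOME C. lattice_basis C L)"
  have C: "lattice_basis C L" unfolding C_def using B by (rule someI)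
  obtain k where k: "det C = of_int k * det B" using lattice_basis_change[OF B C] .
  obtain m where m: "det B = of_int m * det C" using lattice_basis_change[OF C B] .
  have nz: "det B \<noteq> 0" using B by (simp add: lattice_basis_def)
  have "of_int m * (of_int k * det B) = det B"
    unfolding k[symmetric] m[symmetric] by (rule refl)
  then have "real_of_int m * of_int k = 1" using nz by (simp flip: mult.assoc)
  then have "m * k = 1" by (simp flip: of_int_mult)
  then have "k = 1 \<or> k = -1" by (auto simp: zmult_eq_1_iff)
  then have "\<bar>real_of_int k\<bar> = 1" by auto
  then show ?thesis unfolding covolume_def C_def[symmetric] k by (simp add: abs_mult)
qed


section \<open>The order \<open>\<int>[(1 + \<surd>(-l))/2]\<close> and its ideals\<close>

definition quad_order :: "nat \<Rightarrow> complex ring" where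
  "quad_order l = ring_of_type_algebra
     \<lparr>carrier := generate_ring ring_of_type_algebra {(1 + \<i> * of_real (sqrt (real l))) / 2}\<rparr>"

definition nonzero_ideal :: "nat \<Rightarrow> complex set \<Rightarrow> bool" where
  "nonzero_ideal l I \<longleftrightarrow> ideal I (quad_order l) \<and> I \<noteq> {\<zero>\<^bsub>quad_order l\<^esub>}"

definition ideal_norm :: "nat \<Rightarrow> complex set \<Rightarrow> nat" where
  "ideal_norm l I = card (carrier (quad_order l Quot I))"

definition same_ideal_class :: "nat \<Rightarrow> complex set \<Rightarrow> complex set \<Rightarrow> bool" where
  "same_ideal_class l I J \<longleftrightarrow>
     (\<exists>\<alpha>\<in>carrier (quad_order l) - {0}. \<exists>\<beta>\<in>carrier (quad_order l) - {0}.
        (\<lambda>x. \<alpha> * x) ` I = (\<lambda>x. \<beta> * x) ` J)"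


section \<open>The action on Euclidean space and the lattices\<close>

text \<open>Vectors are row vectors. A complex number \<open>\<alpha> = r + s \<surd>(-l)\<close> has \<open>r = Re \<alpha>\<close> and
  \<open>s = Im \<alpha> / \<surd>l\<close>.\<close>

definition act :: "nat \<Rightarrow> real^'n^'n \<Rightarrow> complex \<Rightarrow> real^'n \<Rightarrow> real^'n" where
  "act l W \<alpha> v = v v* (Re \<alpha> *\<^sub>R mat 1 + (Im \<alpha> / sqrt (real l)) *\<^sub>R W)"

definition ideal_times :: "nat \<Rightarrow> real^'n^'n \<Rightarrow> complex set \<Rightarrow> (real^'n) set \<Rightarrow> (real^'n) set" where
  "ideal_times l W I L = group_closure {act l W \<alpha> v | \<alpha> v. \<alpha> \<in> I \<and> v \<in> L}"

definition L_zero :: "(real^'n) set" where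
  "L_zero = {\<chi> j. of_int (a j) | a :: 'n \<Rightarrow> int. [(\<Sum>j\<in>UNIV. a j) = 0] (mod 2)}"

text \<open>The coordinates are indexed by a finite linear order, so that there is a first one.\<close>

definition e_first :: "real^'n::{finite,linorder}" where
  "e_first = axis (Min UNIV) 1"

definition L_plus :: "real^'n::{finite,linorder}^'n::_ \<Rightarrow> (real^'n::_) set" where
  "L_plus W = L_zero \<union> (+) ((1/2) *\<^sub>R (e_first v* (mat 1 + W))) ` L_zero"

definition L_minus :: "real^'n::{finite,linorder}^'n::_ \<Rightarrow> (real^'n::_) set" where
  "L_minus W = L_zero \<union> (+) ((1/2) *\<^sub>R (e_first v* (- mat 1 + W))) ` L_zero"

definition twist :: "nat \<Rightarrow> real^'n^'n \<Rightarrow> (real^'n) set \<Rightarrow> complex set \<Rightarrow> (real^'n) set" where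
  "twist l W L I =
     (\<lambda>v. (1 / sqrt (real (ideal_norm l I))) *\<^sub>R v) ` ideal_times l W I L"

end

theory Submission
  imports Defs
begin

text \<open>
  Multiplication by \<open>\<alpha>\<close> scales inner products by \<open>\<bar>\<alpha>\<bar>\<^sup>2\<close> and has adjoint \<open>cnj \<alpha>\<close>. Two facts about the
  ideal \<open>I\<close> carry the argument, both contained in \<open>I \<cdot> cnj I = N(I) O\<close>, which holds because \<open>l\<close> is squarefree
  and \<open>O\<close> therefore maximal: \<open>\<alpha> cnj \<beta> \<in> N(I) O\<close> for \<open>\<alpha>, \<beta> \<in> I\<close>, and \<open>N(I) = p cnj p' + q cnj q'\<close> for suitable
  \<open>p, q, p', q' \<in> I\<close>. Since \<open>L\<close> is an even self-dual \<open>O\<close>-module, the first makes \<open>L[I]\<close> even and integral, and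
  the second makes it contain its dual, so no index of \<open>I L\<close> in \<open>L\<close> has to be computed. If
  \<open>\<alpha> I = \<beta> J\<close>, then \<open>\<bar>\<alpha>\<bar>\<^sup>2 N(I) = \<bar>\<beta>\<bar>\<^sup>2 N(J)\<close>, and multiplication by \<open>\<alpha> / \<beta>\<close>, rescaled, is the isometry.
\<close>

section \<open>Self-dual subgroups of Euclidean space\<close>

lemma int_combination_mem:
  fixes M :: "'a::real_vector set"
  assumes z: "0 \<in> M" and d: "\<And>u v. u \<in> M \<Longrightarrow> v \<in> M \<Longrightarrow> u - v \<in> M" and u: "u \<in> M"
  shows "of_int k *\<^sub>R u \<in> M"
proof -
  have a: "x + y \<in> M" if "x \<in> M" "y \<in> M" for x y
    using d[OF that(1) d[OF z that(2)]] by simp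
  have n: "of_nat k *\<^sub>R u \<in> M" for k
    by (induction k) (auto simp: z algebra_simps intro!: a u)
  show ?thesis
  proof (cases k)
    case (nonneg m) then show ?thesis using n[of m] by simp
  next
    case (neg m)
    then show ?thesis using d[OF z n[of "Suc m"]]
      by (simp add: scaleR_left_diff_distrib scaleR_left_distrib)
  qed
qed

text \<open>Rows in \<open>M\<close> whose nonzero determinant has minimal absolute value form a basis, since a vector with a
  nonzero fractional coordinate could replace a row and shrink the determinant. The dual basis lies in \<open>M\<close>
  as well, so minimality gives determinant \<open>\<plusminus>1\<close>.\<close>

lemma selfdual_lattice_basis:
  fixes M :: "(real^'n) set" and B :: "real^'n^'n"
  assumes z: "0 \<in> M" and d: "\<And>u v. u \<in> M \<Longrightarrow> v \<in> M \<Longrightarrow> u - v \<in> M"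
    and int: "\<And>u v. u \<in> M \<Longrightarrow> v \<in> M \<Longrightarrow> u \<bullet> v \<in> \<int>"
    and B: "det B \<noteq> 0" "\<And>i. row i B \<in> M"
    and dual: "\<And>x. (\<And>v. v \<in> M \<Longrightarrow> x \<bullet> v \<in> \<int>) \<Longrightarrow> x \<in> M"
  obtains C where "lattice_basis C M" "\<bar>det C\<bar> = 1"
proof -
  have a: "x + y \<in> M" if "x \<in> M" "y \<in> M" for x y
    using d[OF that(1) d[OF z that(2)]] by simp
  have s: "sum f A \<in> M" if "finite A" "\<And>i. i \<in> A \<Longrightarrow> f i \<in> M" for f and A :: "'n set"
    using that by (induction A rule: finite_induct) (auto simp: z intro: a)
  define S where "S = {C :: real^'n^'n. det C \<noteq> 0 \<and> (\<forall>i. row i C \<in> M)}"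
  \<comment> \<open>The square is the determinant of the Gram matrix of the rows, whose entries are
    integers by \<open>int\<close>.\<close>
  have det2: "det C ^ 2 \<in> \<int>" if "C \<in> S" for C
  proof -
    have "(C ** transpose C) $ i $ j = row i C \<bullet> row j C" for i j
      by (simp add: matrix_matrix_mult_def transpose_def row_def inner_vec_def)
    then have "(C ** transpose C) $ i $ j \<in> \<int>" for i j
      using that int by (simp add: S_def)
    then have "det (C ** transpose C) \<in> \<int>"
      unfolding det_def by (auto intro!: Ints_sum Ints_mult Ints_prod)
    then show ?thesis by (simp add: det_mul power2_eq_square)
  qed
  \<comment> \<open>On \<open>S\<close> the squared determinants are nonnegative integers by
    \<open>det2\<close>, so the floor is exact there and only supplies \<open>arg_min\<close> with
    natural numbers.\<close>
  define C where "C = arg_min (\<lambda>C. nat \<lfloor>det C ^ 2\<rfloor>) (\<lambda>C. C \<in> S)"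
  have BS: "B \<in> S" using B by (simp add: S_def)
  have CS: "C \<in> S" unfolding C_def by (rule arg_min_natI[of "\<lambda>C. C \<in> S", OF BS])
  have Cmin: "det C ^ 2 \<le> det D ^ 2" if D: "D \<in> S" for D
  proof -
    have "nat \<lfloor>det C ^ 2\<rfloor> \<le> nat \<lfloor>det D ^ 2\<rfloor>"
      unfolding C_def by (rule arg_min_nat_le[of "\<lambda>C. C \<in> S", OF D])
    then have "\<lfloor>det C ^ 2\<rfloor> \<le> \<lfloor>det D ^ 2\<rfloor>"
      using zero_le_power2[of "det D"] by (simp add: nat_le_eq_zle)
    then show ?thesis
      using det2[OF CS] det2[OF D] by (metis of_int_le_iff of_int_floor)
  qed
  have nz: "det C \<noteq> 0" and rows: "row i C \<in> M" for i using CS by (auto simp: S_def)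
  obtain R where inv: "C ** R = mat 1" and inv': "R ** C = mat 1"
    using nz unfolding invertible_det_nz[symmetric] invertible_def by blast
  have comb: "(\<Sum>i\<in>UNIV. of_int (c i) *\<^sub>R row i C) \<in> M" for c
    by (rule s) (auto intro!: int_combination_mem z d rows)
  have span: "\<exists>c :: 'n \<Rightarrow> int. v = (\<Sum>i\<in>UNIV. of_int (c i) *\<^sub>R row i C)" if v: "v \<in> M" for v
  proof -
    define x where "x = v v* R"
    have vx: "v = (\<Sum>i\<in>UNIV. x $ i *\<^sub>R row i C)"
    proof -
      have "v = x v* C" unfolding x_def by (simp add: vector_matrix_mul_assoc inv')
      then show ?thesis by (simp add: vec_eq_iff vector_matrix_mult_def row_def)
    qed
    define c where "c i = \<lfloor>x $ i\<rfloor>" for i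
    define w where "w = v - (\<Sum>i\<in>UNIV. of_int (c i) *\<^sub>R row i C)"
    define f :: "real^'n" where "f = (\<chi> i. frac (x $ i))"
    have wM: "w \<in> M" unfolding w_def by (intro d v comb)
    have wf: "w = (\<Sum>i\<in>UNIV. f $ i *s row i C)"
      unfolding w_def
      by (subst vx) (simp add: c_def f_def frac_def sum_subtractf scalar_mult_eq_scaleR algebra_simps)
    have "f $ i = 0" for i
    proof (rule ccontr)
      assume f0: "f $ i \<noteq> 0"
      define D where "D = (\<chi> k. if k = i then w else row k C)"
      have dD: "det D = f $ i * det C"
        unfolding D_def wf by (rule cramer_lemma_transpose)
      have "row k D = (if k = i then w else row k C)" for k by (simp add: D_def row_def vec_eq_iff)
      then have "D \<in> S" using dD f0 nz rows wM by (simp add: S_def)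
      then have "det C ^ 2 \<le> (f $ i)^2 * det C ^ 2"
        using Cmin[of D] by (simp add: dD power_mult_distrib)
      then have "1 \<le> (f $ i)^2" using nz by simp
      moreover have "0 \<le> f $ i" "f $ i < 1" by (auto simp: f_def frac_lt_1)
      then have "(f $ i)^2 < 1" by (simp add: abs_square_less_1)
      ultimately show False by simp
    qed
    then have "w = 0" by (simp add: wf)
    then show ?thesis unfolding w_def by auto
  qed
  have basis: "lattice_basis C M"
    unfolding lattice_basis_def using nz comb span by auto
  \<comment> \<open>\<open>R\<close> inverts \<open>C\<close>, so the rows of \<open>P\<close> form
    the basis dual to the rows of \<open>C\<close>.\<close>
  define P where "P = transpose (R)"
  have "row i P \<bullet> row j C = (C ** R) $ j $ i" for i j
    by (simp add: P_def matrix_matrix_mult_def row_def transpose_def inner_vec_def mult.commute)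
  then have PC: "row i P \<bullet> row j C \<in> \<int>" for i j by (simp add: inv mat_def)
  have "row i P \<in> M" for i
  proof (rule dual)
    fix v assume "v \<in> M"
    then obtain c :: "'n \<Rightarrow> int" where "v = (\<Sum>j\<in>UNIV. of_int (c j) *\<^sub>R row j C)" using span by blast
    then show "row i P \<bullet> v \<in> \<int>"
      by (auto simp: inner_sum_right intro!: Ints_sum Ints_mult PC)
  qed
  moreover have detP: "det C * det P = 1"
    unfolding P_def det_transpose det_mul[symmetric] inv by simp
  ultimately have "P \<in> S" using nz by (auto simp: S_def)
  then have "det C ^ 2 \<le> det P ^ 2" by (rule Cmin)
  moreover have "det C ^ 2 * det P ^ 2 = 1" by (metis detP power_mult_distrib power_one)
  moreover have "1 \<le> det C ^ 2"
    using det2[OF CS] nz by (metis Ints_nonzero_abs_ge1 abs_power2 power_not_zero)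
  ultimately have "det C ^ 2 = 1"
    by (smt (verit) mult_le_cancel_left1 mult_less_cancel_right2)
  then have "\<bar>det C\<bar> = 1" by (auto simp: power2_eq_1_iff)
  with basis show ?thesis using that by blast
qed

section \<open>Ideals of the quadratic order\<close>

text \<open>A subgroup of the integers is its own group closure, so \<open>group_closure_eq\<close>
  exhibits \<open>Gcd H\<close> as a generator.\<close>

lemma int_subgroup_multiples:
  fixes H :: "int set"
  assumes z: "0 \<in> H" and d: "\<And>u v. u \<in> H \<Longrightarrow> v \<in> H \<Longrightarrow> u - v \<in> H"
  obtains c where "c \<ge> 0" "\<And>x. x \<in> H \<longleftrightarrow> c dvd x"
proof -
  have "group_closure H \<subseteq> H"
  proof
    fix x assume "x \<in> group_closure H" then show "x \<in> H" by induction (use z d in auto)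
  qed
  then have "group_closure H = H" by (auto intro: group_closure.base)
  then have "H = range (times (Gcd H))" using group_closure_eq[of H] by simp
  then have "x \<in> H \<longleftrightarrow> Gcd H dvd x" for x by (auto simp: dvd_def)
  then show ?thesis using that[of "Gcd H"] by simp
qed

text \<open>The pair \<open>(x, y)\<close> encodes \<open>x + y \<omega>\<close> with \<open>\<omega>\<^sup>2 = \<omega> - m\<close>, so that \<open>om\<close> is closure under
  multiplication by \<open>\<omega>\<close>.\<close>

lemma quadratic_ideal_normal_form:
  fixes Z :: "(int \<times> int) set" and m :: int
  assumes m: "m > 0" and z: "(0, 0) \<in> Z"
    and d: "\<And>x y x' y'. (x, y) \<in> Z \<Longrightarrow> (x', y') \<in> Z \<Longrightarrow> (x - x', y - y') \<in> Z"
    and om: "\<And>x y. (x, y) \<in> Z \<Longrightarrow> (- (m * y), x + y) \<in> Z"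
    and ne: "Z \<noteq> {(0, 0)}"
  obtains a b c k where "a > 0" "c > 0" "b^2 + b + m = a * k"
    "\<And>x y. (x, y) \<in> Z \<longleftrightarrow> c dvd y \<and> c * a dvd x - b * y"
proof -
  have neg: "(- x, - y) \<in> Z" if "(x, y) \<in> Z" for x y using d[OF z that] by simp
  have add: "(x + x', y + y') \<in> Z" if "(x, y) \<in> Z" "(x', y') \<in> Z" for x y x' y'
    using d[OF that(1) neg[OF that(2)]] by simp
  have nmul: "(int n * x, int n * y) \<in> Z" if "(x, y) \<in> Z" for n x y
  proof (induction n)
    case (Suc n) show ?case using add[OF that Suc] by (simp add: algebra_simps)
  qed (simp add: z)
  have mul: "(t * x, t * y) \<in> Z" if "(x, y) \<in> Z" for t x y
  proof (cases "t \<ge> 0")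
    case True then show ?thesis using nmul[OF that, of "nat t"] by simp
  next
    case False then show ?thesis using neg[OF nmul[OF that, of "nat (- t)"]] by simp
  qed
  \<comment> \<open>\<open>c\<close> generates the group of second coordinates, and \<open>e\<close>
    the part of the ideal inside the rational integers; below, \<open>e\<close> becomes
    \<open>c * a\<close>.\<close>
  obtain c where c: "c \<ge> 0" "\<And>y. y \<in> {y. \<exists>x. (x, y) \<in> Z} \<longleftrightarrow> c dvd y"
    using int_subgroup_multiples[of "{y. \<exists>x. (x, y) \<in> Z}"] z d by blast
  obtain e where e: "e \<ge> 0" "\<And>x. x \<in> {x. (x, 0) \<in> Z} \<longleftrightarrow> e dvd x"
    using int_subgroup_multiples[of "{x. (x, 0) \<in> Z}"] z d[of _ 0 _ 0] by auto
  obtain x0 y0 where xy0: "(x0, y0) \<in> Z" "(x0, y0) \<noteq> (0, 0)" using ne z by auto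
  \<comment> \<open>This is the norm of \<open>x0 + y0 \<omega>\<close>, reached on multiplying that
    element by its conjugate \<open>x0 + y0 - y0 \<omega>\<close>. Its positivity rules out
    \<open>e = 0\<close>.\<close>
  have "(x0^2 + x0 * y0 + m * y0^2, 0) \<in> Z"
    using d[OF mul[OF xy0(1), of "x0 + y0"] mul[OF om[OF xy0(1)], of y0]]
    by (simp add: algebra_simps power2_eq_square)
  then have "e dvd x0^2 + x0 * y0 + m * y0^2" using e(2) by blast
  moreover have "x0^2 + x0 * y0 + m * y0^2 > 0"
  proof -
    have "4 * (x0^2 + x0 * y0 + m * y0^2) = (2 * x0 + y0)^2 + (4 * m - 1) * y0^2"
      by (simp add: algebra_simps power2_eq_square)
    moreover have "(2 * x0 + y0)^2 + (4 * m - 1) * y0^2 > 0"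
      using xy0(2) m by (cases "y0 = 0") (auto intro: add_nonneg_pos)
    ultimately have "4 * (x0^2 + x0 * y0 + m * y0^2) > 0" by metis
    then show ?thesis by (metis zero_less_mult_iff zero_less_numeral not_numeral_less_zero)
  qed
  ultimately have e0: "e > 0" using e(1) by (cases "e = 0") auto
  have e0Z: "(e, 0) \<in> Z" using e(2)[of e] by simp
  have "(0, e) \<in> Z" using om[OF e0Z] by simp
  then have ce: "c dvd e" using c(2) by blast
  then have c0: "c > 0" using e0 c(1) by (cases "c = 0") auto
  obtain b' where b': "(b', c) \<in> Z" using c(2)[of c] by auto
  \<comment> \<open>The second coordinate of \<open>\<omega> (b' + c \<omega>)\<close> is
    \<open>b' + c\<close>.\<close>
  have "c dvd b' + c" using om[OF b'] c(2) by blast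
  then have "c dvd b'" by (simp add: dvd_add_left_iff)
  then obtain b where b: "b' = c * b" ..
  obtain a where a: "e = c * a" using ce ..
  have a0: "a > 0" using e0 c0 a by (simp add: zero_less_mult_iff)
  \<comment> \<open>Multiplying \<open>c (b + \<omega>)\<close> by the conjugate
    \<open>b + 1 - \<omega>\<close> of \<open>b + \<omega>\<close> leaves \<open>c\<close> times the
    norm of \<open>b + \<omega>\<close>.\<close>
  have "(c * (b^2 + b + m), 0) \<in> Z"
    using d[OF mul[OF b', of "b + 1"] om[OF b']] unfolding b
    by (simp add: algebra_simps power2_eq_square)
  then have "c * a dvd c * (b^2 + b + m)" using e(2) a by blast
  then have "a dvd b^2 + b + m" using c0 by simp
  then obtain k where k: "b^2 + b + m = a * k" ..
  \<comment> \<open>Subtracting a multiple of \<open>c (b + \<omega>)\<close> clears the second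
    coordinate, so the ideal has the basis \<open>c * a\<close>,
    \<open>c (b + \<omega>)\<close>.\<close>
  have iff: "(x, y) \<in> Z \<longleftrightarrow> c dvd y \<and> c * a dvd x - b * y" for x y
  proof -
    have *: "(x, y) \<in> Z \<longleftrightarrow> (x - b * y, 0) \<in> Z" if t: "y = c * t" for t
    proof -
      have "(b * y, y) \<in> Z" using mul[OF b', of t] by (simp add: t b mult_ac)
      then show ?thesis using d[of x y "b * y" y] add[of "x - b * y" 0 "b * y" y] by auto
    qed
    have "(x, y) \<in> Z \<Longrightarrow> c dvd y" using c(2) by blast
    moreover have "(x - b * y, 0) \<in> Z \<longleftrightarrow> c * a dvd x - b * y" using e(2) a by simp
    ultimately show ?thesis using * by (auto elim!: dvdE[of c y])
  qed
  show ?thesis by (rule that[OF a0 c0 k iff])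
qed

section \<open>Arithmetic of the ring spanned by \<open>1\<close> and
  \<open>\<omega>\<close>\<close>

locale quadratic_order =
  fixes l m :: nat
  assumes l: "l + 1 = 4 * m" and sqfree: "squarefree l"
begin

definition \<omega> :: complex where "\<omega> = (1 + \<i> * of_real (sqrt (real l))) / 2"

definition qint :: "int \<Rightarrow> int \<Rightarrow> complex" where "qint x y = of_int x + of_int y * \<omega>"

definition integers :: "complex set" where "integers = {qint x y | x y. True}"

lemma m_pos: "m > 0" and l_pos: "l > 0"
  using l by (auto intro: Nat.gr0I)

text \<open>\<open>\<omega>\<close> is a root of \<open>t^2 - t + m\<close>, whose discriminant
  \<open>1 - 4 * m\<close> equals \<open>- l\<close>.\<close>

lemma omega_sq: "\<omega> * \<omega> = \<omega> - of_nat m"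
proof -
  define r :: complex where "r = of_real (sqrt (real l))"
  have "r * r = of_nat l"
    unfolding r_def by (metis of_real_mult of_real_of_nat_eq real_sqrt_mult_self abs_of_nat)
  also have "\<dots> = 4 * of_nat m - 1"
    using arg_cong[OF l, of "of_nat :: nat \<Rightarrow> complex"] by (simp add: algebra_simps)
  finally have rr: "r * r = 4 * of_nat m - 1" .
  have \<omega>: "2 * \<omega> = 1 + \<i> * r" by (simp add: \<omega>_def r_def)
  have "4 * (\<omega> * \<omega>) = (2 * \<omega>) * (2 * \<omega>)" by simp
  also have "\<dots> = 1 + 2 * (\<i> * r) - r * r" unfolding \<omega> by (simp add: algebra_simps)
  also have "\<dots> = 2 * (1 + \<i> * r) - 4 * of_nat m" unfolding rr by simp
  also have "\<dots> = 4 * (\<omega> - of_nat m)" unfolding \<omega>[symmetric] by simp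
  finally show ?thesis by (metis mult_cancel_left zero_neq_numeral)
qed

lemma cnj_omega: "cnj \<omega> = 1 - \<omega>"
  by (simp add: \<omega>_def complex_eq_iff)

lemma omega_cnj: "\<omega> * cnj \<omega> = of_nat m"
  by (simp add: cnj_omega algebra_simps omega_sq)

lemma qint_add: "qint x y + qint x' y' = qint (x + x') (y + y')"
  by (simp add: qint_def algebra_simps)

lemma qint_diff: "qint x y - qint x' y' = qint (x - x') (y - y')"
  by (simp add: qint_def algebra_simps)

lemma qint_mult: "qint x y * qint x' y' = qint (x * x' - int m * y * y') (x * y' + x' * y + y * y')"
proof -
  have "qint x y * qint x' y' = of_int x * of_int x' + (of_int x * of_int y' + of_int x' * of_int y) * \<omega>
      + of_int y * of_int y' * (\<omega> * \<omega>)"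
    by (simp add: qint_def algebra_simps)
  also have "\<dots> = qint (x * x' - int m * y * y') (x * y' + x' * y + y * y')"
    unfolding omega_sq by (simp add: qint_def algebra_simps)
  finally show ?thesis .
qed

lemma qint_cnj: "cnj (qint x y) = qint (x + y) (- y)"
  by (simp add: qint_def cnj_omega algebra_simps)

lemma Im_qint: "Im (qint x y) = of_int y * sqrt (real l) / 2"
  by (simp add: qint_def \<omega>_def)

lemma qint_eq_iff: "qint x y = qint x' y' \<longleftrightarrow> x = x' \<and> y = y'"
proof
  assume eq: "qint x y = qint x' y'"
  have "Im (qint x y) = Im (qint x' y')" unfolding eq ..
  then have "y = y'" using l_pos by (simp add: Im_qint)
  then show "x = x' \<and> y = y'" using eq by (simp add: qint_def)
qed simp

lemma of_int_qint: "of_int x = qint x 0" and omega_qint: "\<omega> = qint 0 1"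
  by (simp_all add: qint_def)

lemma qint_integers: "qint x y \<in> integers"
  unfolding integers_def by blast

lemma integersE:
  assumes "\<alpha> \<in> integers" obtains x y where "\<alpha> = qint x y"
  using assms unfolding integers_def by blast

lemma integers_diff: "\<alpha> \<in> integers \<Longrightarrow> \<beta> \<in> integers \<Longrightarrow> \<alpha> - \<beta> \<in> integers"
  by (elim integersE) (simp add: qint_diff qint_integers)

lemma integers_add: "\<alpha> \<in> integers \<Longrightarrow> \<beta> \<in> integers \<Longrightarrow> \<alpha> + \<beta> \<in> integers"
  by (elim integersE) (simp add: qint_add qint_integers)

lemma integers_mult: "\<alpha> \<in> integers \<Longrightarrow> \<beta> \<in> integers \<Longrightarrow> \<alpha> * \<beta> \<in> integers"
  by (elim integersE) (simp add: qint_mult qint_integers)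

lemma integers_of_int: "of_int k \<in> integers"
  unfolding of_int_qint by (rule qint_integers)

lemma integers_omega: "\<omega> \<in> integers"
  unfolding omega_qint by (rule qint_integers)

text \<open>By \<open>omega_sq\<close> the integral span of \<open>1\<close> and
  \<open>\<omega>\<close> is closed under multiplication, so the generated subring is no larger than
  this span. From here on the order is handled through coordinates.\<close>

lemma carrier_quad_order: "carrier (quad_order l) = integers"
proof
  have "h \<in> integers" if "h \<in> generate_ring ring_of_type_algebra {(1 + \<i> * of_real (sqrt (real l))) / 2}"
    for h :: complex
    using that
  proof induction
    case one
    show ?case using integers_of_int[of 1] by (simp add: ring_of_type_algebra_def)
  next
    case (incl h)
    then show ?case using integers_omega unfolding \<omega>_def by blast
  next
    case (a_inv h)
    have "\<ominus>\<^bsub>ring_of_type_algebra\<^esub> h = - h"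
    proof -
      interpret ring "ring_of_type_algebra :: complex ring" by rule
      show ?thesis by (rule minus_equality) (auto simp: ring_of_type_algebra_def)
    qed
    then show ?case using integers_diff[OF integers_of_int[of 0] a_inv.IH] by simp
  next
    case (eng_add h1 h2)
    then show ?case by (simp add: ring_of_type_algebra_def integers_add)
  next
    case (eng_mult h1 h2)
    then show ?case by (simp add: ring_of_type_algebra_def integers_mult)
  qed
  then show "carrier (quad_order l) \<subseteq> integers" by (auto simp: quad_order_def)
next
  let ?G = "generate_ring ring_of_type_algebra {(1 + \<i> * of_real (sqrt (real l))) / 2} :: complex set"
  interpret R: ring "ring_of_type_algebra :: complex ring" by rule
  have sub: "subring ?G ring_of_type_algebra"
    by (rule R.generate_ring_is_subring) (simp add: ring_of_type_algebra_def)
  have mult: "x * y \<in> ?G" if "x \<in> ?G" "y \<in> ?G" for x y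
    using subringE(6)[OF sub that] by (simp add: ring_of_type_algebra_def)
  have add: "x + y \<in> ?G" if "x \<in> ?G" "y \<in> ?G" for x y
    using subringE(7)[OF sub that] by (simp add: ring_of_type_algebra_def)
  have one: "1 \<in> ?G" using subringE(3)[OF sub] by (simp add: ring_of_type_algebra_def)
  have zero: "0 \<in> ?G" using subringE(2)[OF sub] by (simp add: ring_of_type_algebra_def)
  have minus: "- x \<in> ?G" if "x \<in> ?G" for x
  proof -
    have "\<ominus>\<^bsub>ring_of_type_algebra\<^esub> x = - x"
      by (rule R.minus_equality) (auto simp: ring_of_type_algebra_def)
    then show ?thesis using subringE(5)[OF sub that] by simp
  qed
  have nat: "of_nat k \<in> ?G" for k by (induction k) (auto intro: add one zero)
  have int: "of_int k \<in> ?G" for k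
  proof (cases k)
    case (nonneg j) then show ?thesis using nat[of j] by simp
  next
    case (neg j) then show ?thesis using minus[OF nat[of "Suc j"]] by simp
  qed
  have "\<omega> \<in> ?G" unfolding \<omega>_def by (rule generate_ring.incl) simp
  then have "qint x y \<in> ?G" for x y unfolding qint_def by (intro add mult int)
  then show "integers \<subseteq> carrier (quad_order l)" by (auto simp: integers_def quad_order_def)
qed

text \<open>A vanishing imaginary part kills the \<open>\<omega>\<close> coordinate. This turns real
  quotients found in the order, such as a norm divided by an ideal norm, into rational
  integers.\<close>

lemma real_integer:
  assumes "of_real r \<in> integers" shows "r \<in> \<int>"
proof -
  obtain x y where xy: "of_real r = qint x y" using assms by (auto simp: integers_def)
  have "Im (qint x y) = 0" unfolding xy[symmetric] by simp
  then have "y = 0" using l_pos by (simp add: Im_qint)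
  then have "of_real r = (of_real (of_int x) :: complex)" using xy by (simp add: qint_def)
  then show ?thesis by (metis Ints_of_int of_real_eq_iff)
qed

section \<open>Ideals in coordinates, their norms and their conjugates\<close>

lemma nonzero_idealD:
  assumes "nonzero_ideal l I"
  shows "I \<subseteq> integers"
    and "0 \<in> I"
    and "\<And>x y. x \<in> I \<Longrightarrow> y \<in> I \<Longrightarrow> x - y \<in> I"
    and "\<And>a x. a \<in> integers \<Longrightarrow> x \<in> I \<Longrightarrow> a * x \<in> I"
    and "I \<noteq> {0}"
proof -
  interpret ideal I "quad_order l" using assms by (simp add: nonzero_ideal_def)
  have zero: "\<zero>\<^bsub>quad_order l\<^esub> = 0" by (simp add: quad_order_def ring_of_type_algebra_def)
  show sub: "I \<subseteq> integers" using a_subset by (simp add: carrier_quad_order)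
  show "0 \<in> I" using additive_subgroup.zero_closed[OF is_additive_subgroup] by (simp add: zero)
  show mult: "a * x \<in> I" if "a \<in> integers" "x \<in> I" for a x
    using I_l_closed[of x a] that
    by (simp add: carrier_quad_order) (simp add: quad_order_def ring_of_type_algebra_def)
  show "x - y \<in> I" if "x \<in> I" "y \<in> I" for x y
  proof -
    have "- y \<in> I" using mult[OF integers_of_int[of "-1"] that(2)] by simp
    then have "x \<oplus>\<^bsub>quad_order l\<^esub> (- y) \<in> I"
      using additive_subgroup.a_closed[OF is_additive_subgroup that(1)] by blast
    then show ?thesis by (simp add: quad_order_def ring_of_type_algebra_def)
  qed
  show "I \<noteq> {0}" using assms by (simp add: nonzero_ideal_def zero)
qed

text \<open>The ideal has the basis \<open>c * a\<close>, \<open>c (b + \<omega>)\<close>. Each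
  coset then has exactly one representative in a box of sides \<open>c * a\<close> and
  \<open>c\<close>, which gives the norm.\<close>

lemma nonzero_ideal_normal_form:
  assumes I: "nonzero_ideal l I"
  obtains a b c k where "a > 0" "c > 0" "b^2 + b + int m = a * k"
    "\<And>x y. qint x y \<in> I \<longleftrightarrow> c dvd y \<and> c * a dvd x - b * y"
    "ideal_norm l I = nat (c * c * a)"
proof -
  note D = nonzero_idealD[OF I]
  define Z where "Z = {(x, y). qint x y \<in> I}"
  have om: "(- (int m * y), x + y) \<in> Z" if "(x, y) \<in> Z" for x y
    using D(4)[OF integers_omega, of "qint x y"] that by (simp add: Z_def omega_qint qint_mult)
  have z: "(0, 0) \<in> Z" using D(2) of_int_qint[of 0] by (simp add: Z_def)
  have ne: "Z \<noteq> {(0, 0)}"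
  proof -
    obtain \<alpha> where "\<alpha> \<in> I" "\<alpha> \<noteq> 0" using D(2,5) by blast
    moreover then obtain x y where "\<alpha> = qint x y" using D(1) by (auto simp: integers_def)
    ultimately have "(x, y) \<in> Z" "(x, y) \<noteq> (0, 0)" using of_int_qint[of 0] by (auto simp: Z_def)
    then show ?thesis by blast
  qed
  have d: "(x - x', y - y') \<in> Z" if "(x, y) \<in> Z" "(x', y') \<in> Z" for x y x' y'
    using D(3) that by (simp add: Z_def flip: qint_diff)
  obtain a b c k where abck: "a > 0" "c > 0" "b^2 + b + int m = a * k"
    and iff': "\<And>x y. (x, y) \<in> Z \<longleftrightarrow> c dvd y \<and> c * a dvd x - b * y"
    using quadratic_ideal_normal_form[of "int m" Z] z d om ne m_pos by (metis of_nat_0_less_iff)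
  then have iff: "qint x y \<in> I \<longleftrightarrow> c dvd y \<and> c * a dvd x - b * y" for x y by (simp add: Z_def)
  define F where "F = (\<lambda>(x, y). (\<lambda>i. i + qint x y) ` I)"
  have Feq: "F (x, y) = F (x', y') \<longleftrightarrow> qint (x - x') (y - y') \<in> I" for x y x' y'
  proof
    assume "F (x, y) = F (x', y')"
    then have "0 + qint x y \<in> F (x', y')" using D(2) unfolding F_def by blast
    then show "qint (x - x') (y - y') \<in> I" by (auto simp: F_def simp flip: qint_diff)
  next
    assume A: "qint (x - x') (y - y') \<in> I"
    have B: "i - j \<in> I" "i + j \<in> I" if "i \<in> I" "j \<in> I" for i j
      using D(3)[OF that(1) D(3)[OF D(2) that(2)]] D(3)[OF that] by simp_all
    have "i + qint x y = (i + qint (x - x') (y - y')) + qint x' y'"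
      "i + qint x' y' = (i - qint (x - x') (y - y')) + qint x y" for i
      by (simp_all flip: qint_diff)
    then show "F (x, y) = F (x', y')" using B[OF _ A] unfolding F_def by fast
  qed
  have carrier: "carrier (quad_order l Quot I) = range F"
    unfolding FactRing_def A_RCOSETS_def' a_r_coset_def' carrier_quad_order integers_def F_def
    by (auto simp: quad_order_def ring_of_type_algebra_def A_RCOSETS_def' a_r_coset_def' image_def)
  define R where "R = {0..<c * a} \<times> {0..<c}"
  have "range F \<subseteq> F ` R"
  proof
    fix cs assume "cs \<in> range F"
    then obtain x y where cs: "cs = F (x, y)" by auto
    \<comment> \<open>The second coordinate is reduced first, by a multiple of
      \<open>c (b + \<omega>)\<close>. This shifts the first coordinate by
      \<open>b * (y - v)\<close>, and only then is that one reduced modulo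
      \<open>c * a\<close>.\<close>
    define v where "v = y mod c"
    define u where "u = (x - b * (y - v)) mod (c * a)"
    have "c dvd y - v" by (simp add: v_def)
    moreover have "c * a dvd (x - b * (y - v)) - u" unfolding u_def by (rule dvd_minus_mod)
    then have "c * a dvd (x - u) - b * (y - v)" by (simp add: algebra_simps)
    ultimately have "cs = F (u, v)" unfolding cs Feq iff by blast
    moreover have "(u, v) \<in> R" using abck(1,2) by (simp add: R_def u_def v_def)
    ultimately show "cs \<in> F ` R" by blast
  qed
  then have "range F = F ` R" by blast
  moreover have "inj_on F R"
  proof (rule inj_onI, clarify)
    fix x y x' y' assume xy: "(x, y) \<in> R" "(x', y') \<in> R" and "F (x, y) = F (x', y')"
    then have c: "c dvd y - y'" and ca: "c * a dvd (x - x') - b * (y - y')" by (auto simp: Feq iff)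
    have "\<bar>y - y'\<bar> < \<bar>c\<bar>" "\<bar>x - x'\<bar> < \<bar>c * a\<bar>" using xy by (auto simp: R_def)
    then have "y = y'" using c dvd_imp_le_int[of "y - y'" c] by force
    moreover then have "x = x'" using ca \<open>\<bar>x - x'\<bar> < _\<close> dvd_imp_le_int[of "x - x'" "c * a"] by force
    ultimately show "x = x' \<and> y = y'" by simp
  qed
  moreover have "card R = nat (c * c * a)"
    using abck(1,2) by (simp add: R_def card_cartesian_product nat_mult_distrib mult_ac)
  ultimately have "ideal_norm l I = nat (c * c * a)"
    unfolding ideal_norm_def carrier by (simp add: card_image)
  then show ?thesis using that abck iff by blast
qed

text \<open>The square of a common divisor of \<open>a\<close>, \<open>2 b + 1\<close> and \<open>k\<close> divides \<open>4 a k - (2 b + 1)\<^sup>2 = l\<close>.\<close>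

lemma coprime_coefficients:
  fixes a b k :: int
  assumes "b^2 + b + int m = a * k"
  obtains r s t where "r * a + s * (2 * b + 1) + t * k = 1"
proof -
  define g where "g = gcd a (gcd (2 * b + 1) k)"
  have "int l = 4 * (a * k) - (2 * b + 1)^2"
    using l unfolding assms[symmetric] by (simp add: power2_eq_square algebra_simps)
  moreover have "g dvd a" "g dvd 2 * b + 1" "g dvd k"
    unfolding g_def by (meson dvd_trans gcd_dvd1 gcd_dvd2)+
  then have "g^2 dvd a * k" "g^2 dvd (2 * b + 1)^2"
    by (auto simp: power2_eq_square mult_dvd_mono)
  ultimately have "g^2 dvd int l" by (simp add: dvd_diff)
  then have "nat g ^ 2 dvd l"
    by (metis g_def gcd_ge_0_int int_nat_eq nat_0_le of_nat_dvd_iff of_nat_power)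
  then have "nat g dvd 1" using sqfree by (simp add: squarefree_def)
  then have g: "g = 1" by (simp add: g_def)
  obtain s t where st: "s * (2 * b + 1) + t * k = gcd (2 * b + 1) k" using bezout_int by blast
  obtain r u where "r * a + u * gcd (2 * b + 1) k = g" using bezout_int g_def by blast
  then have "r * a + (u * s) * (2 * b + 1) + (u * t) * k = 1"
    unfolding st[symmetric] g by (simp add: algebra_simps)
  then show ?thesis using that by blast
qed

text \<open>The two inclusions of \<open>I \<cdot> cnj I = N(I) O\<close>.\<close>

lemma ideal_times_cnj:
  assumes I: "nonzero_ideal l I"
  shows ideal_norm_pos: "ideal_norm l I > 0"
    and ideal_cnj_dvd: "\<And>\<alpha> \<beta>. \<alpha> \<in> I \<Longrightarrow> \<beta> \<in> I \<Longrightarrow>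
      \<exists>\<gamma>\<in>integers. \<alpha> * cnj \<beta> = of_nat (ideal_norm l I) * \<gamma>"
    and ideal_norm_cnj: "\<exists>p\<in>I. \<exists>q\<in>I. \<exists>p'\<in>I. \<exists>q'\<in>I.
      of_nat (ideal_norm l I) = p * cnj p' + q * cnj q'"
proof -
  note D = nonzero_idealD[OF I]
  obtain a b c k where pos: "a > 0" "c > 0" and k: "b^2 + b + int m = a * k"
    and iff: "\<And>x y. qint x y \<in> I \<longleftrightarrow> c dvd y \<and> c * a dvd x - b * y"
    and N: "ideal_norm l I = nat (c * c * a)"
    using nonzero_ideal_normal_form[OF I] by metis
  show "ideal_norm l I > 0" using pos by (simp add: N)
  have Nc: "of_nat (ideal_norm l I) = qint (c * c * a) 0"
    using pos by (simp add: N qint_def)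
  have mk: "int m = a * k - b^2 - b" using k by simp
  \<comment> \<open>\<open>e s t\<close> is \<open>c (a s + (b + \<omega>) t)\<close>, the element
    with coordinates \<open>s\<close>, \<open>t\<close> in the basis of \<open>I\<close>.\<close>
  define e where "e s t = qint (c * a * s + c * b * t) (c * t)" for s t
  have eI: "e s t \<in> I" for s t
    unfolding e_def iff by (simp add: algebra_simps)
  \<comment> \<open>Every term of the expanded product shows the factor \<open>c * c * a\<close>
    except \<open>c^2 t t' (b^2 + b + m)\<close>, the norm of \<open>b + \<omega>\<close> scaled;
    there \<open>mk\<close> brings in \<open>a * k\<close>.\<close>
  have prod: "e s t * cnj (e s' t') = of_nat (ideal_norm l I)
      * qint (s * s' * a + s * t' * (b + 1) + s' * t * b + t * t' * k) (s' * t - s * t')" for s t s' t'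
    unfolding Nc e_def qint_cnj qint_mult qint_eq_iff mk
    by (simp add: algebra_simps power2_eq_square)
  have ex: "\<exists>s t. \<alpha> = e s t" if \<alpha>: "\<alpha> \<in> I" for \<alpha>
  proof -
    obtain x y where xy: "\<alpha> = qint x y" using D(1) \<alpha> by (auto simp: integers_def)
    then obtain s t where "y = c * t" "x - b * y = c * a * s" using \<alpha> iff by (metis dvdE)
    then have "\<alpha> = e s t" unfolding xy e_def qint_eq_iff by (simp add: algebra_simps)
    then show ?thesis by blast
  qed
  show "\<exists>\<gamma>\<in>integers. \<alpha> * cnj \<beta> = of_nat (ideal_norm l I) * \<gamma>" if "\<alpha> \<in> I" "\<beta> \<in> I" for \<alpha> \<beta>
    using ex[OF that(1)] ex[OF that(2)] prod qint_integers by blast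
  obtain r s t where rst: "r * a + s * (2 * b + 1) + t * k = 1"
    using coprime_coefficients[OF k] .
  \<comment> \<open>Up to the norm factor the summands are
    \<open>r a + s (b + 1) - s \<omega>\<close> and \<open>s b + t k + s \<omega>\<close>: the
    \<open>\<omega>\<close> parts cancel, and \<open>rst\<close> makes the rest equal to
    \<open>1\<close>.\<close>
  have "e 1 0 * cnj (e r s) + e 0 1 * cnj (e s t) = of_nat (ideal_norm l I) * qint 1 0"
    unfolding prod distrib_left[symmetric] qint_add using rst by (simp add: algebra_simps)
  then have "of_nat (ideal_norm l I) = e 1 0 * cnj (e r s) + e 0 1 * cnj (e s t)"
    by (simp add: qint_def)
  then show "\<exists>p\<in>I. \<exists>q\<in>I. \<exists>p'\<in>I. \<exists>q'\<in>I. of_nat (ideal_norm l I) = p * cnj p' + q * cnj q'"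
    using eI by blast
qed

text \<open>Expand \<open>ideal_norm l I\<close> by \<open>ideal_norm_cnj\<close>, carry each factor
  from \<open>\<alpha> I\<close> over to \<open>\<beta> J\<close>, and apply
  \<open>ideal_cnj_dvd\<close> to \<open>J\<close>: the quotient of the two sides lies in the order,
  so it is an integer. By symmetry its inverse is an integer too, and a positive integer with
  integral inverse is \<open>1\<close>.\<close>

lemma same_ideal_class_norm:
  assumes I: "nonzero_ideal l I" and J: "nonzero_ideal l J"
    and ab: "\<alpha> \<noteq> 0" "\<beta> \<noteq> 0" and eq: "(\<lambda>x. \<alpha> * x) ` I = (\<lambda>x. \<beta> * x) ` J"
  shows "cmod \<alpha> ^ 2 * real (ideal_norm l I) = cmod \<beta> ^ 2 * real (ideal_norm l J)"
proof -
  have *: "cmod \<alpha> ^ 2 * real (ideal_norm l I) / (cmod \<beta> ^ 2 * real (ideal_norm l J)) \<in> \<int>"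
    if I: "nonzero_ideal l I" and J: "nonzero_ideal l J"
      and ab: "\<beta> \<noteq> 0" and eq: "(\<lambda>x. \<alpha> * x) ` I = (\<lambda>x. \<beta> * x) ` J" for \<alpha> \<beta> I J
  proof -
    obtain p q p' q' where pq: "p \<in> I" "q \<in> I" "p' \<in> I" "q' \<in> I"
      and N: "of_nat (ideal_norm l I) = p * cnj p' + q * cnj q'" using ideal_norm_cnj[OF I] by blast
    have "\<exists>y\<in>J. \<alpha> * x = \<beta> * y" if "x \<in> I" for x using that eq by blast
    then obtain f where f: "\<And>x. x \<in> I \<Longrightarrow> f x \<in> J \<and> \<alpha> * x = \<beta> * f x" by metis
    obtain \<gamma> where \<gamma>: "\<gamma> \<in> integers" "f p * cnj (f p') = of_nat (ideal_norm l J) * \<gamma>"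
      using ideal_cnj_dvd[OF J] f pq by metis
    obtain \<delta> where \<delta>: "\<delta> \<in> integers" "f q * cnj (f q') = of_nat (ideal_norm l J) * \<delta>"
      using ideal_cnj_dvd[OF J] f pq by metis
    have "\<alpha> * cnj \<alpha> * of_nat (ideal_norm l I)
        = (\<alpha> * p) * cnj (\<alpha> * p') + (\<alpha> * q) * cnj (\<alpha> * q')"
      unfolding N by (simp add: algebra_simps)
    also have "\<dots> = (\<beta> * f p) * cnj (\<beta> * f p') + (\<beta> * f q) * cnj (\<beta> * f q')"
      using f pq by metis
    also have "\<dots> = \<beta> * cnj \<beta> * (f p * cnj (f p') + f q * cnj (f q'))"
      by (simp add: algebra_simps)
    also have "\<dots> = \<beta> * cnj \<beta> * of_nat (ideal_norm l J) * (\<gamma> + \<delta>)"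
      unfolding \<gamma> \<delta> by (simp add: algebra_simps)
    finally have "of_real (cmod \<alpha> ^ 2 * real (ideal_norm l I))
        = of_real (cmod \<beta> ^ 2 * real (ideal_norm l J)) * (\<gamma> + \<delta>)"
      by (simp only: of_real_mult complex_norm_square of_real_of_nat_eq)
    then have "of_real (cmod \<alpha> ^ 2 * real (ideal_norm l I) / (cmod \<beta> ^ 2 * real (ideal_norm l J)))
        = \<gamma> + \<delta>"
      using ab ideal_norm_pos[OF J] by (simp add: field_simps)
    moreover have "\<gamma> + \<delta> \<in> integers"
      using \<gamma>(1) \<delta>(1) by (rule integers_add)
    ultimately show ?thesis using real_integer by simp
  qed
  define t where "t = cmod \<alpha> ^ 2 * real (ideal_norm l I) / (cmod \<beta> ^ 2 * real (ideal_norm l J))"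
  have "t > 0" using ab ideal_norm_pos[OF I] ideal_norm_pos[OF J] by (simp add: t_def)
  moreover have "t \<in> \<int>" unfolding t_def using *[OF I J ab(2) eq] .
  moreover have "1 / t \<in> \<int>" unfolding t_def using *[OF J I ab(1) eq[symmetric]] by simp
  ultimately have "t \<ge> 1" "1 / t \<ge> 1"
    using Ints_nonzero_abs_ge1[of t] Ints_nonzero_abs_ge1[of "1 / t"] by auto
  then have "t = 1" by (simp add: le_divide_eq)
  then show ?thesis using ab ideal_norm_pos[OF J] by (simp add: t_def field_simps)
qed

end

section \<open>The action and the twisted lattices\<close>

lemma half_Ints_diff_cong:
  fixes f g :: "'a \<Rightarrow> real"
  assumes "\<And>i. i \<in> A \<Longrightarrow> (f i - g i) / 2 \<in> \<int>"
  shows "sum f A / 2 \<in> \<int> \<longleftrightarrow> sum g A / 2 \<in> \<int>"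
proof -
  have "(\<Sum>i\<in>A. (f i - g i) / 2) \<in> \<int>" using assms by (rule Ints_sum)
  moreover have "(\<Sum>i\<in>A. (f i - g i) / 2) = sum f A / 2 - sum g A / 2"
    by (simp add: sum_subtractf sum_divide_distrib diff_divide_distrib)
  ultimately show ?thesis
    using Ints_diff[of "sum f A / 2" "sum f A / 2 - sum g A / 2"]
      Ints_add[of "sum f A / 2 - sum g A / 2" "sum g A / 2"] by auto
qed

text \<open>Evenness is expressed as integrality of the half. A sign change preserves parity because
  \<open>a i * w i - a i\<close> is \<open>0\<close> or \<open>- 2 * a i\<close>.\<close>

lemma half_Ints_sign_sum:
  fixes a w :: "'a \<Rightarrow> real"
  assumes "\<And>i. i \<in> A \<Longrightarrow> w i \<in> {-1, 1}" "\<And>i. i \<in> A \<Longrightarrow> a i \<in> \<int>"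
  shows "(\<Sum>i\<in>A. a i * w i) / 2 \<in> \<int> \<longleftrightarrow> sum a A / 2 \<in> \<int>"
  by (rule half_Ints_diff_cong) (use assms in force)

lemma L_zero_iff:
  "v \<in> L_zero \<longleftrightarrow> (\<forall>i. v $ i \<in> \<int>) \<and> (\<Sum>i\<in>UNIV. v $ i) / 2 \<in> \<int>"
proof
  assume "v \<in> L_zero"
  then obtain a :: "'a \<Rightarrow> int" where v: "v = (\<chi> j. of_int (a j))" and a: "[(\<Sum>j\<in>UNIV. a j) = 0] (mod 2)"
    unfolding L_zero_def by blast
  obtain k where k: "(\<Sum>j\<in>UNIV. a j) = 2 * k" using a by (auto simp: cong_0_iff)
  have "(\<Sum>i\<in>UNIV. v $ i) = of_int (\<Sum>j\<in>UNIV. a j)" by (simp add: v)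
  then have "(\<Sum>i\<in>UNIV. v $ i) / 2 = of_int k" unfolding k by simp
  then show "(\<forall>i. v $ i \<in> \<int>) \<and> (\<Sum>i\<in>UNIV. v $ i) / 2 \<in> \<int>" by (simp add: v)
next
  assume *: "(\<forall>i. v $ i \<in> \<int>) \<and> (\<Sum>i\<in>UNIV. v $ i) / 2 \<in> \<int>"
  define a where "a i = \<lfloor>v $ i\<rfloor>" for i
  have v: "v $ i = of_int (a i)" for i using * by (simp add: a_def)
  obtain k :: int where "(\<Sum>i\<in>UNIV. v $ i) / 2 = of_int k" using * by (auto elim: Ints_cases)
  then have "of_int (\<Sum>j\<in>UNIV. a j) = (of_int (2 * k) :: real)" by (simp add: v)
  then have "(\<Sum>j\<in>UNIV. a j) = 2 * k" by (simp only: of_int_eq_iff)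
  then have "[(\<Sum>j\<in>UNIV. a j) = 0] (mod 2)" by (simp add: cong_0_iff)
  then show "v \<in> L_zero" unfolding L_zero_def using v by (auto simp: vec_eq_iff intro!: exI[of _ a])
qed

text \<open>An integer and its square have the same parity, so the coordinate sum may be replaced by
  the norm. This form suits maps that scale norms.\<close>

lemma L_zero_iff_norm:
  "v \<in> L_zero \<longleftrightarrow> (\<forall>i. v $ i \<in> \<int>) \<and> (v \<bullet> v) / 2 \<in> \<int>"
proof -
  have "(x * x - x) / 2 \<in> \<int>" if x: "x \<in> \<int>" for x :: real
  proof -
    obtain k where k: "x = of_int k" using x by (rule Ints_cases)
    have "even (k * k - k)" by simp
    then obtain j where "k * k - k = 2 * j" ..
    then have "x * x - x = 2 * of_int j" unfolding k by (metis of_int_diff of_int_mult of_int_numeral)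
    then show ?thesis by simp
  qed
  then show ?thesis
    unfolding L_zero_iff inner_vec_def
    using half_Ints_diff_cong[of UNIV "\<lambda>i. v $ i \<bullet> v $ i" "\<lambda>i. v $ i"] by auto
qed

lemma L_zero_diff: "u \<in> L_zero \<Longrightarrow> v \<in> L_zero \<Longrightarrow> u - v \<in> L_zero"
  by (auto simp: L_zero_iff sum_subtractf diff_divide_distrib)

lemma L_zero_zero: "0 \<in> L_zero"
  by (simp add: L_zero_iff)

lemma L_zero_axis:
  "axis i 1 + axis j 1 \<in> L_zero" "axis i 1 - axis j 1 \<in> L_zero"
  by (auto simp: L_zero_iff axis_def sum.distrib sum_subtractf)

lemma L_zero_even_axis: "even k \<Longrightarrow> of_nat k *\<^sub>R axis i 1 \<in> L_zero"
  by (auto simp: L_zero_iff axis_def if_distrib cong: if_cong elim!: evenE)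

section \<open>The action of complex numbers through \<open>W\<close>\<close>

locale skew_action = quadratic_order l m for l m +
  fixes W :: "real^'n::finite^'n"
  assumes skew: "transpose W = - W"
    and orth: "W ** transpose W = real l *\<^sub>R mat 1"
begin

lemma act_eq: "act l W \<alpha> v = Re \<alpha> *\<^sub>R v + (Im \<alpha> / sqrt (real l)) *\<^sub>R (v v* W)"
  by (simp add: act_def vector_matrix_mult_add_rdistrib vector_scaleR_matrix_ac scaleR_vector_matrix_assoc)

text \<open>Skewness turns \<open>W ** transpose W\<close> into \<open>- (W ** W)\<close>, so
  \<open>W\<close> acts as a square root of \<open>- l\<close>.\<close>

lemma W_W: "(v v* W) v* W = - (real l *\<^sub>R v)"
proof -
  have "W ** W = - (W ** transpose W)"
    unfolding skew by (simp add: matrix_matrix_mult_def vec_eq_iff sum_negf)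
  then have "(v v* W) v* W = v v* (- (real l *\<^sub>R mat 1))"
    unfolding vector_matrix_mul_assoc orth by simp
  also have "\<dots> = v v* ((- real l) *\<^sub>R mat 1)" by simp
  finally show ?thesis by (simp only: vector_scaleR_matrix_ac vector_matrix_mul_rid) simp
qed

lemma W_inner: "(u v* W) \<bullet> v = - (u \<bullet> (v v* W))"
proof -
  have "W *v v = - (transpose W *v v)"
    unfolding skew by (simp add: matrix_vector_mult_def vec_eq_iff sum_negf)
  then show ?thesis by (simp add: dot_lmul_matrix)
qed

lemma act_add_right: "act l W \<alpha> (u + v) = act l W \<alpha> u + act l W \<alpha> v"
  by (simp add: act_def vector_matrix_left_distrib)

lemma act_diff_right: "act l W \<alpha> (u - v) = act l W \<alpha> u - act l W \<alpha> v"
  by (simp add: act_def vector_matrix_mult_diff_distrib)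

lemma act_scaleR: "act l W \<alpha> (r *\<^sub>R v) = r *\<^sub>R act l W \<alpha> v"
  by (simp add: act_def scaleR_vector_matrix_assoc)

lemma act_zero_right: "act l W \<alpha> 0 = 0"
  by (simp add: act_def)

lemma act_add_left: "act l W (\<alpha> + \<beta>) v = act l W \<alpha> v + act l W \<beta> v"
  by (simp add: act_eq add_divide_distrib algebra_simps)

lemma act_of_real: "act l W (of_real r) v = r *\<^sub>R v"
  by (simp add: act_eq)

text \<open>In the product of the two \<open>W\<close> parts, the factor \<open>- l\<close> from
  \<open>W_W\<close> absorbs both divisions by \<open>sqrt l\<close> and leaves
  \<open>- Im \<alpha> * Im \<beta>\<close>.\<close>

lemma act_mult: "act l W (\<alpha> * \<beta>) v = act l W \<alpha> (act l W \<beta> v)"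
proof -
  define s where "s = sqrt (real l)"
  have s: "s \<noteq> 0" "s * s = real l" using l_pos by (auto simp: s_def)
  have "(Im \<alpha> / s) * (Im \<beta> / s) * real l = Im \<alpha> * Im \<beta>" unfolding s(2)[symmetric] using s(1) by simp
  then have "act l W \<alpha> (act l W \<beta> v) = (Re \<alpha> * Re \<beta> - Im \<alpha> * Im \<beta>) *\<^sub>R v
     + (Re \<alpha> * (Im \<beta> / s) + (Im \<alpha> / s) * Re \<beta>) *\<^sub>R (v v* W)"
    by (simp add: act_eq vector_matrix_left_distrib scaleR_vector_matrix_assoc W_W algebra_simps flip: s_def)
  then show ?thesis by (simp add: act_eq add_divide_distrib flip: s_def)
qed

lemma act_inner: "act l W \<alpha> u \<bullet> v = u \<bullet> act l W (cnj \<alpha>) v"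
  by (simp add: act_eq inner_add_left inner_diff_right W_inner)

lemma act_inner_act: "act l W \<alpha> u \<bullet> act l W \<beta> v = u \<bullet> act l W (cnj \<alpha> * \<beta>) v"
  by (simp add: act_inner act_mult)

lemma act_norm: "act l W \<alpha> u \<bullet> act l W \<alpha> v = (cmod \<alpha>)\<^sup>2 * (u \<bullet> v)"
proof -
  have "cnj \<alpha> * \<alpha> = of_real ((cmod \<alpha>)\<^sup>2)" by (simp only: complex_norm_square mult.commute)
  then show ?thesis by (simp only: act_inner_act act_of_real inner_scaleR_right)
qed

lemma act_omega: "act l W \<omega> v = (1/2) *\<^sub>R (v + v v* W)"
  using l_pos by (simp add: act_eq \<omega>_def algebra_simps)

lemma omega_norm: "(cmod \<omega>)\<^sup>2 = real m"
proof -
  have "of_real ((cmod \<omega>)\<^sup>2) = (of_nat m :: complex)" by (simp only: complex_norm_square omega_cnj)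
  then show ?thesis by (metis of_real_eq_iff of_real_of_nat_eq)
qed

text \<open>\<open>\<delta>\<close> may be any complex number, so that a quotient of two elements of
  the order, possibly outside the order, can be inserted.\<close>

lemma ideal_times_act:
  assumes "\<And>x. x \<in> I \<Longrightarrow> \<delta> * x \<in> J" and "v \<in> ideal_times l W I L"
  shows "act l W \<delta> v \<in> ideal_times l W J L"
  using assms(2) unfolding ideal_times_def
proof induction
  case (base s)
  \<comment> \<open>\<open>group_closure\<close> adjoins \<open>0\<close> to its generators, whence
    the first case.\<close>
  then consider "s = 0" | \<alpha> u where "s = act l W \<alpha> u" "\<alpha> \<in> I" "u \<in> L" by blast
  then show ?case
  proof cases
    case 1 then show ?thesis by (simp add: act_zero_right)
  next
    case 2
    then show ?thesis using assms(1) by (intro group_closure.base) (auto simp flip: act_mult)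
  qed
next
  case (diff s t)
  then show ?case unfolding act_diff_right using diff.IH by (intro group_closure.diff)
qed

lemma twist_isometric:
  assumes I: "nonzero_ideal l I" and J: "nonzero_ideal l J" and c: "same_ideal_class l I J"
  shows "isometric_lattices (twist l W L I) (twist l W L J)"
proof -
  obtain \<alpha> \<beta> where ab: "\<alpha> \<noteq> 0" "\<beta> \<noteq> 0" and eq: "(\<lambda>x. \<alpha> * x) ` I = (\<lambda>x. \<beta> * x) ` J"
    using c unfolding same_ideal_class_def by blast
  define NI where "NI = real (ideal_norm l I)"
  define NJ where "NJ = real (ideal_norm l J)"
  have pos: "NI > 0" "NJ > 0" using ideal_norm_pos I J by (auto simp: NI_def NJ_def)
  define \<delta> where "\<delta> = \<alpha> / \<beta>"
  define \<epsilon> where "\<epsilon> = \<beta> / \<alpha>"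
  have de: "\<delta> * \<epsilon> = of_real 1" using ab by (simp add: \<delta>_def \<epsilon>_def)
  have "(cmod \<delta>)\<^sup>2 * NI = NJ"
    using same_ideal_class_norm[OF I J ab eq] ab
    by (simp add: \<delta>_def NI_def NJ_def norm_divide power_divide field_simps)
  then have nrm: "(sqrt NI / sqrt NJ)\<^sup>2 * (cmod \<delta>)\<^sup>2 = 1"
    using pos by (simp add: power_divide field_simps)
  have dI: "\<delta> * x \<in> J" if x: "x \<in> I" for x
  proof -
    obtain y where "y \<in> J" "\<alpha> * x = \<beta> * y" using eq x by blast
    moreover then have "\<delta> * x = y" using ab by (simp add: \<delta>_def field_simps)
    ultimately show ?thesis by simp
  qed
  have eJ: "\<epsilon> * y \<in> I" if y: "y \<in> J" for y
  proof -
    obtain x where "x \<in> I" "\<alpha> * x = \<beta> * y" using eq y by (metis (no_types, lifting) image_iff)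
    moreover then have "\<epsilon> * y = x" using ab by (simp add: \<epsilon>_def field_simps)
    ultimately show ?thesis by simp
  qed
  have image: "act l W \<delta> ` ideal_times l W I L = ideal_times l W J L"
  proof
    show "act l W \<delta> ` ideal_times l W I L \<subseteq> ideal_times l W J L"
      using ideal_times_act[OF dI] by blast
    show "ideal_times l W J L \<subseteq> act l W \<delta> ` ideal_times l W I L"
    proof
      fix v assume "v \<in> ideal_times l W J L"
      then have "act l W \<epsilon> v \<in> ideal_times l W I L" using ideal_times_act[OF eJ] by blast
      moreover have "v = act l W \<delta> (act l W \<epsilon> v)"
        unfolding act_mult[symmetric] de act_of_real by simp
      ultimately show "v \<in> act l W \<delta> ` ideal_times l W I L" by blast
    qed
  qed
  \<comment> \<open>The scalar undoes the factor \<open>1 / sqrt NI\<close> of the source and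
    supplies the factor \<open>1 / sqrt NJ\<close> of the target; by \<open>nrm\<close> it exactly
    compensates the scaling by \<open>\<delta>\<close>.\<close>
  define f where "f v = (sqrt NI / sqrt NJ) *\<^sub>R act l W \<delta> v" for v
  have "f v \<bullet> f w = (sqrt NI / sqrt NJ)\<^sup>2 * (cmod \<delta>)\<^sup>2 * (v \<bullet> w)" for v w
    by (simp add: f_def act_norm power2_eq_square)
  then have inner: "f v \<bullet> f w = v \<bullet> w" for v w by (simp add: nrm)
  have "linear f" by (rule linearI) (simp_all add: f_def act_add_right act_scaleR scaleR_add_right)
  then have "orthogonal_transformation f" using inner by (simp add: orthogonal_transformation_def)
  moreover have "f ` twist l W L I = twist l W L J"
    unfolding twist_def image[symmetric] image_image f_def act_scaleR
    using pos by (simp flip: NI_def NJ_def)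
  ultimately show ?thesis unfolding isometric_lattices_def by blast
qed

end

section \<open>Twisting an even self-dual module by an ideal\<close>

locale selfdual_module = skew_action l m W for l m and W :: "real^'n::finite^'n" +
  fixes L :: "(real^'n) set"
  assumes L_zero_mem: "0 \<in> L"
    and L_diff: "u \<in> L \<Longrightarrow> v \<in> L \<Longrightarrow> u - v \<in> L"
    and L_inner: "u \<in> L \<Longrightarrow> v \<in> L \<Longrightarrow> u \<bullet> v \<in> \<int>"
    and L_even: "u \<in> L \<Longrightarrow> (u \<bullet> u) / 2 \<in> \<int>"
    and L_dual: "(\<And>v. v \<in> L \<Longrightarrow> x \<bullet> v \<in> \<int>) \<Longrightarrow> x \<in> L"
    and L_omega: "u \<in> L \<Longrightarrow> act l W \<omega> u \<in> L"
    and L_axis: "2 *\<^sub>R axis i 1 \<in> L"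
begin

lemma L_act:
  assumes "\<alpha> \<in> integers" "u \<in> L" shows "act l W \<alpha> u \<in> L"
proof -
  obtain x y where xy: "\<alpha> = qint x y" using assms(1) by (rule integersE)
  have "\<alpha> = of_real (of_int x) + of_real (of_int y) * \<omega>" by (simp add: xy qint_def)
  then have "act l W \<alpha> u = of_int x *\<^sub>R u + of_int y *\<^sub>R act l W \<omega> u"
    by (simp only: act_add_left act_mult act_of_real)
  also have "\<dots> = of_int x *\<^sub>R u - of_int (- y) *\<^sub>R act l W \<omega> u" by simp
  also have "\<dots> \<in> L"
    by (intro L_diff int_combination_mem[OF L_zero_mem] L_omega assms(2))
  finally show ?thesis .
qed

lemma twist_selfdual:
  assumes I: "nonzero_ideal l I"
  shows twist_even: "even_lattice (twist l W L I)"
    and twist_unimodular: "unimodular_lattice (twist l W L I)"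
proof -
  note D = nonzero_idealD[OF I]
  define N where "N = real (ideal_norm l I)"
  have N: "N > 0" using ideal_norm_pos[OF I] by (simp add: N_def)
  then have sN: "sqrt N * sqrt N = N" "sqrt N > 0" by auto
  have Nc: "of_nat (ideal_norm l I) = complex_of_real N" by (simp add: N_def)
  define K where "K = ideal_times l W I L"
  define M where "M = twist l W L I"
  have M: "M = (\<lambda>v. (1 / sqrt N) *\<^sub>R v) ` K" by (simp add: M_def twist_def N_def K_def)
  have gen: "act l W \<alpha> v \<in> K" if "\<alpha> \<in> I" "v \<in> L" for \<alpha> v
    unfolding K_def ideal_times_def using that by (intro group_closure.base) blast
  have K0: "0 \<in> K" by (simp add: K_def ideal_times_def)
  have Kd: "u - v \<in> K" if "u \<in> K" "v \<in> K" for u v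
    using that unfolding K_def ideal_times_def by (rule group_closure.diff)
  \<comment> \<open>Closure induction in which the difference step also knows that both operands lie
    in \<open>K\<close>; evenness needs this to use the integrality of their inner product.\<close>
  have Kind: "P u" if u: "u \<in> K" and P0: "P 0" and gen: "\<And>\<alpha> v. \<alpha> \<in> I \<Longrightarrow> v \<in> L \<Longrightarrow> P (act l W \<alpha> v)"
    and df: "\<And>u v. u \<in> K \<Longrightarrow> v \<in> K \<Longrightarrow> P u \<Longrightarrow> P v \<Longrightarrow> P (u - v)" for P u
    using u unfolding K_def ideal_times_def
  proof induction
    case (base s) then show ?case using P0 gen by blast
  next
    case (diff s t) then show ?case using df unfolding K_def ideal_times_def by blast
  qed
  have inner1: "(act l W \<alpha> u \<bullet> act l W \<beta> v) / N \<in> \<int>"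
    if ab: "\<alpha> \<in> I" "\<beta> \<in> I" and uv: "u \<in> L" "v \<in> L" for \<alpha> \<beta> u v
  proof -
    obtain \<gamma> where \<gamma>: "\<gamma> \<in> integers" "\<beta> * cnj \<alpha> = of_nat (ideal_norm l I) * \<gamma>"
      using ideal_cnj_dvd[OF I ab(2,1)] by blast
    have "act l W \<alpha> u \<bullet> act l W \<beta> v = u \<bullet> act l W (complex_of_real N * \<gamma>) v"
      unfolding act_inner_act using \<gamma>(2) by (simp add: Nc mult.commute)
    also have "\<dots> = N * (u \<bullet> act l W \<gamma> v)" by (simp add: act_mult act_of_real)
    finally show ?thesis using N L_inner[OF uv(1) L_act[OF \<gamma>(1) uv(2)]] by simp
  qed
  \<comment> \<open>Integrality passes from generators to all of \<open>K\<close> one argument at a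
    time.\<close>
  have inner2: "(u \<bullet> act l W \<beta> v) / N \<in> \<int>" if u: "u \<in> K" and "\<beta> \<in> I" "v \<in> L" for u \<beta> v
    using u by (rule Kind) (use inner1 that in \<open>auto simp: inner_diff_left diff_divide_distrib\<close>)
  have inner: "(u \<bullet> v) / N \<in> \<int>" if u: "u \<in> K" and v: "v \<in> K" for u v
    using v by (rule Kind) (use inner2 u in \<open>auto simp: inner_diff_right diff_divide_distrib\<close>)
  have even: "(u \<bullet> u) / N / 2 \<in> \<int>" if u: "u \<in> K" for u
    using u
  proof (rule Kind)
    fix \<alpha> v assume \<alpha>: "\<alpha> \<in> I" and v: "v \<in> L"
    obtain \<gamma> where \<gamma>: "\<gamma> \<in> integers" "\<alpha> * cnj \<alpha> = of_nat (ideal_norm l I) * \<gamma>"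
      using ideal_cnj_dvd[OF I \<alpha> \<alpha>] by blast
    then have "of_real ((cmod \<alpha>)\<^sup>2) = of_real N * \<gamma>" by (simp only: complex_norm_square Nc)
    then have "of_real ((cmod \<alpha>)\<^sup>2 / N) = \<gamma>" using N by (simp add: field_simps)
    then have "(cmod \<alpha>)\<^sup>2 / N \<in> \<int>" using real_integer \<gamma>(1) by metis
    then have "(cmod \<alpha>)\<^sup>2 / N * ((v \<bullet> v) / 2) \<in> \<int>" using L_even[OF v] by (rule Ints_mult)
    then show "(act l W \<alpha> v \<bullet> act l W \<alpha> v) / N / 2 \<in> \<int>" by (simp add: act_norm)
  next
    fix u v assume uv: "u \<in> K" "v \<in> K" and *: "(u \<bullet> u) / N / 2 \<in> \<int>" "(v \<bullet> v) / N / 2 \<in> \<int>"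
    have "((u - v) \<bullet> (u - v)) / N / 2 = (u \<bullet> u) / N / 2 + (v \<bullet> v) / N / 2 - (u \<bullet> v) / N"
      by (simp add: inner_diff_left inner_diff_right inner_commute[of v u] diff_divide_distrib add_divide_distrib)
    then show "((u - v) \<bullet> (u - v)) / N / 2 \<in> \<int>" using * inner[OF uv] by simp
  qed simp
  have M0: "0 \<in> M" unfolding M using K0 by force
  have Md: "u - v \<in> M" if "u \<in> M" "v \<in> M" for u v
    using that Kd unfolding M by (auto simp flip: scaleR_diff_right)
  have Minner: "u \<bullet> v \<in> \<int>" if "u \<in> M" "v \<in> M" for u v
    using that inner sN unfolding M by (auto simp: mult.commute)
  have Meven: "(u \<bullet> u) / 2 \<in> \<int>" if "u \<in> M" for u
    using that even sN unfolding M by auto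
  have Mdual: "x \<in> M" if x: "\<And>v. v \<in> M \<Longrightarrow> x \<bullet> v \<in> \<int>" for x
  proof -
    \<comment> \<open>Moving \<open>cnj \<alpha>\<close> across the inner product pairs
      \<open>x\<close> with a generator of \<open>M\<close>, so self-duality of \<open>L\<close>
      applies.\<close>
    have xL: "(1 / sqrt N) *\<^sub>R act l W (cnj \<alpha>) x \<in> L" if \<alpha>: "\<alpha> \<in> I" for \<alpha>
    proof (rule L_dual)
      fix v assume v: "v \<in> L"
      have "((1 / sqrt N) *\<^sub>R act l W (cnj \<alpha>) x) \<bullet> v = x \<bullet> ((1 / sqrt N) *\<^sub>R act l W \<alpha> v)"
        by (simp add: act_inner)
      also have "\<dots> \<in> \<int>" by (rule x) (use gen[OF \<alpha> v] in \<open>auto simp: M\<close>)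
      finally show "((1 / sqrt N) *\<^sub>R act l W (cnj \<alpha>) x) \<bullet> v \<in> \<int>" .
    qed
    obtain p q p' q' where pq: "p \<in> I" "q \<in> I" "p' \<in> I" "q' \<in> I"
      and Npq: "of_nat (ideal_norm l I) = p * cnj p' + q * cnj q'" using ideal_norm_cnj[OF I] by blast
    \<comment> \<open>Both vectors lie in \<open>K\<close> by \<open>xL\<close>. Since
      \<open>p cnj p' + q cnj q'\<close> is the norm, their sum is \<open>N / sqrt N\<close> times
      \<open>x\<close>, which places \<open>x\<close> in \<open>M\<close>.\<close>
    define u where "u = act l W p ((1 / sqrt N) *\<^sub>R act l W (cnj p') x)"
    define v where "v = act l W q ((1 / sqrt N) *\<^sub>R act l W (cnj q') x)"
    have "u - (0 - v) \<in> K" unfolding u_def v_def using pq by (intro Kd K0 gen xL)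
    then have uv: "u + v \<in> K" by simp
    have "u + v = (1 / sqrt N) *\<^sub>R act l W (complex_of_real N) x"
      unfolding u_def v_def Nc[symmetric] Npq act_add_left act_mult act_scaleR
      by (simp add: scaleR_add_right)
    also have "\<dots> = sqrt N *\<^sub>R x" unfolding act_of_real using N by (simp add: real_div_sqrt)
    finally have "x = (1 / sqrt N) *\<^sub>R (u + v)" using N by simp
    then show "x \<in> M" unfolding M using uv by blast
  qed
  obtain p where p: "p \<in> I" "p \<noteq> 0" using D(2,5) by blast
  \<comment> \<open>Multiplication by \<open>p\<close> scales inner products, so the rows stay
    pairwise orthogonal with common squared length \<open>k\<close> below. Hence \<open>B\<close> is
    invertible, as \<open>selfdual_lattice_basis\<close> requires.\<close>
  define B :: "real^'n^'n" where "B = (\<chi> i. (1 / sqrt N) *\<^sub>R act l W p (2 *\<^sub>R axis i 1))"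
  have row: "row i B = (1 / sqrt N) *\<^sub>R act l W p (2 *\<^sub>R axis i 1)" for i
    by (simp add: B_def row_def vec_eq_iff)
  then have rowM: "row i B \<in> M" for i unfolding M using gen[OF p(1) L_axis] by auto
  define k where "k = 4 * (cmod p)\<^sup>2 / N"
  have k: "k \<noteq> 0" using p N by (simp add: k_def)
  have "row i B \<bullet> row j B = (if i = j then k else 0)" for i j
    unfolding row using sN by (simp add: act_scaleR act_norm k_def inner_axis_axis)
  then have "(B ** ((1 / k) *\<^sub>R transpose B)) $ i $ j = (mat 1 :: real^'n^'n) $ i $ j" for i j
    using k by (simp add: matrix_matrix_mult_def transpose_def inner_vec_def row_def mat_def
        sum_divide_distrib[symmetric])
  then have "B ** ((1 / k) *\<^sub>R transpose B) = mat 1" by (simp add: vec_eq_iff)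
  then have "det B \<noteq> 0" unfolding invertible_det_nz[symmetric] invertible_right_inverse by blast
  then obtain C where C: "lattice_basis C M" "\<bar>det C\<bar> = 1"
    using selfdual_lattice_basis[of M B] M0 Md Minner rowM Mdual by metis
  then have lat: "is_lattice M" by (auto simp: is_lattice_def)
  show "even_lattice (twist l W L I)"
    unfolding M_def[symmetric] even_lattice_def
  proof (intro conjI ballI lat)
    fix u assume "u \<in> M"
    then obtain j :: int where "(u \<bullet> u) / 2 = of_int j" using Meven by (meson Ints_cases)
    then have "even (2 * j) \<and> u \<bullet> u = of_int (2 * j)" by simp
    then show "\<exists>k::int. even k \<and> u \<bullet> u = of_int k" by blast
  qed
  show "unimodular_lattice (twist l W L I)"
    unfolding M_def[symmetric] unimodular_lattice_def integral_lattice_def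
    using lat Minner covolume_eq[OF C(1)] C(2) by simp
qed

end

section \<open>The glued lattices \<open>L_plus\<close> and \<open>L_minus\<close>\<close>

locale conference_matrix = skew_action l m W for l m and W :: "real^'n::{finite,linorder}^'n::_" +
  assumes diag: "W $ i $ i = 0"
    and offdiag: "i \<noteq> j \<Longrightarrow> W $ i $ j \<in> {-1, 1}"
    and m_even: "even m"
begin

text \<open>All entries of \<open>mat 1 + W\<close> are signs, so each doubled coordinate of the
  image has the parity of the coordinate sum of \<open>v\<close>, which is even. The parity
  condition on the image follows because its norm is \<open>m\<close> times that of
  \<open>v\<close>.\<close>

lemma L_zero_omega:
  assumes v: "v \<in> L_zero" shows "act l W \<omega> v \<in> L_zero"
proof -
  have "act l W \<omega> v $ j \<in> \<int>" for j
  proof -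
    have "v + v v* W = v v* (mat 1 + W)" by (simp add: vector_matrix_mult_add_rdistrib)
    then have "(v + v v* W) $ j = (\<Sum>i\<in>UNIV. v $ i * (mat 1 + W) $ i $ j)"
      by (simp only: vector_matrix_mult_def vec_lambda_beta)
    then have "act l W \<omega> v $ j = (\<Sum>i\<in>UNIV. v $ i * (mat 1 + W) $ i $ j) / 2"
      by (simp add: act_omega)
    moreover have "(mat 1 + W) $ i $ j \<in> {-1, 1}" for i
      using diag offdiag by (simp add: mat_def)
    ultimately show ?thesis
      using v half_Ints_sign_sum[of UNIV "\<lambda>i. (mat 1 + W) $ i $ j" "\<lambda>i. v $ i"]
      by (metis L_zero_iff)
  qed
  moreover have "(act l W \<omega> v \<bullet> act l W \<omega> v) / 2 \<in> \<int>"
  proof -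
    have "(act l W \<omega> v \<bullet> act l W \<omega> v) / 2 = of_nat m * ((v \<bullet> v) / 2)"
      by (simp add: act_norm omega_norm)
    then show ?thesis using v by (metis L_zero_iff_norm Ints_mult Ints_of_nat)
  qed
  ultimately show ?thesis by (simp add: L_zero_iff_norm)
qed

text \<open>Serves both choices of sign. As \<open>h\<close> is half a sign vector, an integral
  vector pairs integrally with \<open>h\<close> exactly when its coordinate sum is even; this drives
  both integrality and self-duality. Stability under \<open>\<omega>\<close> has to be checked on
  \<open>h\<close> only, by \<open>L_zero_omega\<close>.\<close>

lemma glue_selfdual_module:
  fixes h :: "real^'n::_"
  assumes sgn: "\<And>i. 2 * h $ i \<in> {-1, 1}" and hh: "h \<bullet> h = real m"
    and om: "act l W \<omega> h \<in> L_zero \<union> (+) h ` L_zero"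
  shows "selfdual_module l m W (L_zero \<union> (+) h ` L_zero)"
proof -
  define L where "L = L_zero \<union> (+) h ` L_zero"
  have Lh: "h + u \<in> L" if "u \<in> L_zero" for u using that by (simp add: L_def)
  have L0: "u \<in> L" if "u \<in> L_zero" for u using that by (simp add: L_def)
  have Lcases: "u \<in> L_zero \<or> u - h \<in> L_zero" if "u \<in> L" for u using that by (auto simp: L_def)
  \<comment> \<open>The cosets of \<open>h\<close> and \<open>- h\<close> thus agree, so the union
    is closed under differences.\<close>
  have h2: "2 *\<^sub>R h \<in> L_zero"
  proof -
    have "(2 *\<^sub>R h) $ i \<in> \<int>" for i using sgn[of i] by auto
    then show ?thesis by (simp add: L_zero_iff_norm hh)
  qed
  have hu: "u \<bullet> h \<in> \<int> \<longleftrightarrow> (\<Sum>i\<in>UNIV. u $ i) / 2 \<in> \<int>" if "\<And>i. u $ i \<in> \<int>" for u :: "real^'n::_"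
  proof -
    have "u \<bullet> h = (\<Sum>i\<in>UNIV. u $ i * (2 * h $ i)) / 2" by (simp add: inner_vec_def sum_divide_distrib)
    then show ?thesis using half_Ints_sign_sum[of UNIV "\<lambda>i. 2 * h $ i" "\<lambda>i. u $ i"] sgn that by metis
  qed
  have diff: "u - v \<in> L" if "u \<in> L" "v \<in> L" for u v
  proof -
    have *: "u - v = (u - h) - (v - h)" "u - v = h + ((u - h) - v)" "u - v = h + ((u - (v - h)) - 2 *\<^sub>R h)"
      by (simp_all add: algebra_simps scaleR_2)
    show ?thesis
      using Lcases[OF that(1)] Lcases[OF that(2)] L_zero_diff L_zero_diff[OF _ h2] L0 Lh * by metis
  qed
  have even: "(u \<bullet> u) / 2 \<in> \<int>" if "u \<in> L" for u
    using Lcases[OF that]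
  proof
    assume "u \<in> L_zero" then show ?thesis by (simp add: L_zero_iff_norm)
  next
    define v where "v = u - h"
    assume "u - h \<in> L_zero"
    then have v: "v \<in> L_zero" by (simp add: v_def)
    have "u = h + v" by (simp add: v_def)
    then have "(u \<bullet> u) / 2 = real m / 2 + v \<bullet> h + (v \<bullet> v) / 2"
      by (simp add: inner_add_left inner_add_right hh inner_commute[of h v] add_divide_distrib)
    moreover have "real m / 2 \<in> \<int>" using m_even by (auto elim: evenE)
    moreover have "v \<bullet> h \<in> \<int>" using v hu by (simp add: L_zero_iff)
    moreover have "(v \<bullet> v) / 2 \<in> \<int>" using v by (simp add: L_zero_iff_norm)
    ultimately show ?thesis by (metis Ints_add)
  qed
  \<comment> \<open>Polarization: even norms on a group force integral inner products.\<close>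
  have inner: "u \<bullet> v \<in> \<int>" if "u \<in> L" "v \<in> L" for u v
  proof -
    have "u \<bullet> v = (u \<bullet> u) / 2 + (v \<bullet> v) / 2 - ((u - v) \<bullet> (u - v)) / 2"
      by (simp add: inner_diff_left inner_diff_right inner_commute[of v u] field_simps)
    then show ?thesis using even that diff[OF that] by simp
  qed
  have dual: "x \<in> L" if x: "\<And>v. v \<in> L \<Longrightarrow> x \<bullet> v \<in> \<int>" for x
  proof -
    \<comment> \<open>The differences make all coordinates congruent modulo \<open>1\<close>, and
      the sums with \<open>i = j\<close> make their doubles integers. So the coordinates are all
      integers or all half-odd, matching the two cosets.\<close>
    have pm: "x $ i + x $ j \<in> \<int>" "x $ i - x $ j \<in> \<int>" for i j
      using x[OF L0[OF L_zero_axis(1)[of i j]]] x[OF L0[OF L_zero_axis(2)[of i j]]]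
      by (simp_all add: inner_add_right inner_diff_right inner_axis)
    have xh: "x \<bullet> h \<in> \<int>" using x[OF Lh[OF L_zero_zero]] by simp
    show ?thesis
    proof (cases "\<forall>i. x $ i \<in> \<int>")
      case True
      then have "x \<in> L_zero" using hu xh by (simp add: L_zero_iff)
      then show ?thesis by (rule L0)
    next
      case False
      then obtain i0 where i0: "x $ i0 \<notin> \<int>" by blast
      have int: "(x - h) $ i \<in> \<int>" for i
      proof -
        have "x $ i \<notin> \<int>" using i0 Ints_add[OF pm(2)[of i0 i], of "x $ i"] by auto
        moreover have "x $ i + x $ i \<in> \<int>" by (rule pm(1))
        then obtain k where k: "x $ i + x $ i = of_int k" by (rule Ints_cases)
        ultimately have "odd k" by (auto elim!: evenE)
        then obtain j where "k = 2 * j + 1" by (rule oddE)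
        then have xj: "x $ i = of_int j + 1/2" using k by simp
        consider "h $ i = 1/2" | "h $ i = -1/2" using sgn[of i] by fastforce
        then show ?thesis
        proof cases
          case 1 then have "(x - h) $ i = of_int j" by (simp add: xj)
          then show ?thesis by (metis Ints_of_int)
        next
          case 2 then have "(x - h) $ i = of_int (j + 1)" by (simp add: xj)
          then show ?thesis by (metis Ints_of_int)
        qed
      qed
      have "(x - h) \<bullet> h \<in> \<int>" using xh by (simp add: inner_diff_left hh)
      then have "x - h \<in> L_zero" using hu[OF int] int by (simp add: L_zero_iff)
      from Lh[OF this] show ?thesis by simp
    qed
  qed
  have omega: "act l W \<omega> u \<in> L" if "u \<in> L" for u
    using Lcases[OF that]
  proof
    assume "u \<in> L_zero" then show ?thesis by (intro L0 L_zero_omega)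
  next
    assume "u - h \<in> L_zero"
    then have "0 - act l W \<omega> (u - h) \<in> L" by (intro diff L0 L_zero_zero L_zero_omega)
    with om[folded L_def] have "act l W \<omega> h - (0 - act l W \<omega> (u - h)) \<in> L" by (rule diff)
    then show ?thesis by (simp add: act_diff_right)
  qed
  have "2 *\<^sub>R axis i 1 \<in> L" for i using L0[OF L_zero_even_axis[of 2 i]] by simp
  then show ?thesis
    unfolding L_def[symmetric]
    by unfold_locales (use L0[OF L_zero_zero] diff inner even dual omega in auto)
qed

lemma half_sign_row:
  assumes "s \<in> {-1, 1}"
  shows "2 * ((1/2) *\<^sub>R (axis i 1 v* (s *\<^sub>R mat 1 + W))) $ j \<in> {-1, 1}"
proof -
  have "(axis i 1 v* (s *\<^sub>R mat 1 + W)) $ j = (s *\<^sub>R mat 1 + W) $ i $ j"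
    by (simp add: vector_matrix_mult_def axis_def if_distrib if_distribR cong: if_cong)
  also have "\<dots> \<in> {-1, 1}" using assms diag offdiag by (auto simp: mat_def)
  finally show ?thesis by simp
qed

text \<open>The glue vector is \<open>h = \<omega> e_first\<close>, so \<open>omega_sq\<close> gives
  \<open>\<omega> h = h - m e_first\<close>. This lies in the coset of \<open>h\<close> because
  \<open>m\<close> is even.\<close>

lemma selfdual_module_L_plus: "selfdual_module l m W (L_plus W)"
proof -
  have me: "of_nat m *\<^sub>R e_first \<in> L_zero"
    using m_even unfolding e_first_def by (rule L_zero_even_axis)
  define h where "h = (1/2) *\<^sub>R (e_first v* (mat 1 + W))"
  have h: "h = act l W \<omega> e_first"
    by (simp add: h_def act_omega vector_matrix_mult_add_rdistrib)
  have "act l W \<omega> h = act l W (\<omega> + of_real (- real m)) e_first"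
    unfolding h act_mult[symmetric] omega_sq by simp
  also have "\<dots> = h - of_nat m *\<^sub>R e_first" unfolding act_add_left act_of_real h by simp
  also have "\<dots> = h + (0 - of_nat m *\<^sub>R e_first)" by simp
  finally have "act l W \<omega> h \<in> (+) h ` L_zero"
    using L_zero_diff[OF L_zero_zero me] by blast
  moreover have "h \<bullet> h = real m"
    unfolding h act_norm omega_norm by (simp add: e_first_def inner_axis_axis)
  moreover have "2 * h $ i \<in> {-1, 1}" for i
    using half_sign_row[of 1 "Min UNIV" i] by (simp add: h_def e_first_def)
  ultimately show ?thesis
    unfolding L_plus_def h_def[symmetric] by (intro glue_selfdual_module) auto
qed

text \<open>The glue vector is \<open>(\<omega> - 1) e_first = - cnj \<omega> e_first\<close>, so
  \<open>\<omega> h = - m e_first\<close>, which falls into \<open>L_zero\<close> itself because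
  \<open>m\<close> is even.\<close>

lemma selfdual_module_L_minus: "selfdual_module l m W (L_minus W)"
proof -
  have me: "of_nat m *\<^sub>R e_first \<in> L_zero"
    using m_even unfolding e_first_def by (rule L_zero_even_axis)
  define h where "h = (1/2) *\<^sub>R (e_first v* (- mat 1 + W))"
  have "h = (1/2) *\<^sub>R (e_first v* W - e_first)"
    using vector_matrix_mult_diff_rdistrib[of e_first W "mat 1"] by (simp add: h_def)
  then have "h = act l W \<omega> e_first - e_first"
    by (simp add: act_omega vec_eq_iff field_simps)
  also have "\<dots> = act l W (\<omega> + of_real (- 1)) e_first" unfolding act_add_left act_of_real by simp
  also have "\<omega> + of_real (- 1) = - cnj \<omega>" by (simp add: cnj_omega)
  finally have h: "h = act l W (- cnj \<omega>) e_first" .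
  have "\<omega> * (- cnj \<omega>) = of_real (- real m)" using omega_cnj by simp
  then have "act l W \<omega> h = 0 - of_nat m *\<^sub>R e_first"
    unfolding h act_mult[symmetric] by (simp only: act_of_real) simp
  then have "act l W \<omega> h \<in> L_zero"
    using L_zero_diff[OF L_zero_zero me] by simp
  moreover have "h \<bullet> h = real m"
    unfolding h act_norm by (simp add: omega_norm e_first_def inner_axis_axis)
  moreover have "2 * h $ i \<in> {-1, 1}" for i
    using half_sign_row[of "-1" "Min UNIV" i] by (simp add: h_def e_first_def)
  ultimately show ?thesis
    unfolding L_minus_def h_def[symmetric] by (intro glue_selfdual_module) auto
qed

end

theorem theorem3p3:
  fixes n l :: nat
    and W :: "real^'n::{finite,linorder}^'n::_"
    and L :: "(real^'n::_) set"
  assumes "n > 0" and "CARD('n) = n" and "l = n - 1"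
    and "squarefree l" and "[l = 7] (mod 8)"
    and "transpose W = - W"
    and "\<forall>i. W $ i $ i = 0"
    and "\<forall>i j. i \<noteq> j \<longrightarrow> W $ i $ j \<in> {-1, 1}"
    and "W ** transpose W = (real n - 1) *\<^sub>R mat 1"
    and "L = L_plus W \<or> L = L_minus W"
  shows "(\<forall>I. nonzero_ideal l I \<longrightarrow>
            even_lattice (twist l W L I) \<and> unimodular_lattice (twist l W L I)) \<and>
         (\<forall>I J. nonzero_ideal l I \<and> nonzero_ideal l J \<and> same_ideal_class l I J \<longrightarrow>
            isometric_lattices (twist l W L I) (twist l W L J))"
proof -
  \<comment> \<open>With \<open>q = l div 8\<close>, \<open>l + 1 = 8 (q + 1)\<close>, so
    \<open>m = 2 (q + 1)\<close>: the residue modulo 8 is what makes \<open>m\<close>, the norm of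
    the glue vectors, even.\<close>
  have "l mod 8 = 7" using assms(5) by (simp add: cong_def)
  then obtain m where m: "l + 1 = 4 * m" "even m"
    using that[of "2 * (l div 8 + 1)"] div_mult_mod_eq[of l 8] by auto
  have "real n - 1 = real l" using assms(1,3) by simp
  then interpret conference_matrix l m W
    using assms m by unfold_locales auto
  interpret selfdual_module l m W L
    using assms(10) selfdual_module_L_plus selfdual_module_L_minus by auto
  show ?thesis using twist_even twist_unimodular twist_isometric by blast
qed

end
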